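(* Let $n\ge 1$ be an integer. The map $f$, which sends a special partition $\pi\in\mathcal P_{[2n+1]}$ to the sequence $f(\pi)=(a_1,a_2,\dots,a_n)$ obtained by listing the nonzero differences of $\pi$, reversing their order and dividing by two, is a bijection between $\mathcal P_{[2n+1]}$ and $\mathcal S_n$.
   Context: For a positive integer $m$, $[m]=\{1,\dots,m\}$. A set partition $\pi=\{B_1,\dots,B_k\}$ of $[m]$ into nonempty blocks is non-crossing if whenever $a<b<c<d$ with $a,c\in B_i$ and $b,d\in B_j$, then $i=j$. $\mathcal P_{[2n+1]}$ denotes the set of non-crossing partitions of $[2n+1]$ into exactly $n+1$ blocks such that no block contains two consecutive integers (two integers $x,x+1$); its elements are called special partitions. $\mathcal S_n$ denotes the set of integer sequences $s_1,s_2,\dots,s_n$ such that (i) $1\le s_i\le i$ for all $1\le i\le n$, and (ii) if $s_i=j$, then $s_{i-r}\le j-r$ for all $1\le r\le j-1$. Definition of $f$: given $\pi\in\mathcal P_{[2n+1]}$, define its sequence of differences $d_1,\dots,d_{2n+1}$ as follows. For $i\in[2n+1]$, let $B$ be the block of $\pi$ containing $i$. If $i$ is not the largest element of $B$, then $d_i=i'-i$, where $i'$ is the smallest element of $B$ greater than $i$; if $i$ is the largest element of $B$, then $d_i=0$. Since $\pi$ has $n+1$ blocks, exactly $n$ of the $d_i$ are nonzero; let $i_1<i_2<\dots<i_n$ be the indices with $d_{i_k}\neq 0$. All these differences are even. Set $a_j=d_{i_{n-j+1}}/2$ for $1\le j\le n$, and $f(\pi)=(a_1,\dots,a_n)$.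 *)

theory Defs
  imports "HOL-Library.Disjoint_Sets"
begin

definition noncrossing :: "nat set set \<Rightarrow> bool" where
  "noncrossing \<pi> \<longleftrightarrow>
     (\<forall>B\<in>\<pi>. \<forall>C\<in>\<pi>. \<forall>a b c d.
        a < b \<and> b < c \<and> c < d \<and> a \<in> B \<and> c \<in> B \<and> b \<in> C \<and> d \<in> C \<longrightarrow> B = C)"

definition special_partitions :: "nat \<Rightarrow> nat set set set" where
  "special_partitions n =
     {\<pi>. partition_on {1..2*n+1} \<pi> \<and> noncrossing \<pi> \<and> card \<pi> = n + 1 \<and>
         (\<forall>B\<in>\<pi>. \<forall>x. \<not> (x \<in> B \<and> x + 1 \<in> B))}"

definition block_of :: "nat set set \<Rightarrow> nat \<Rightarrow> nat set" where
  "block_of \<pi> i = (THE B. B \<in> \<pi> \<and> i \<in> B)"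

definition difference :: "nat set set \<Rightarrow> nat \<Rightarrow> int" where
  "difference \<pi> i =
     (let B = block_of \<pi> i
      in if i = Max B then 0 else int (Min {i'\<in>B. i < i'}) - int i)"

definition difference_seq :: "nat \<Rightarrow> nat set set \<Rightarrow> int list" where
  "difference_seq n \<pi> = map (difference \<pi>) [1..<2*n+2]"

(* On special partitions the integer division is exact, see difference_even below. *)
definition f :: "nat \<Rightarrow> nat set set \<Rightarrow> int list" where
  "f n \<pi> = map (\<lambda>d. d div 2) (rev (filter (\<lambda>d. d \<noteq> 0) (difference_seq n \<pi>)))"

(* A sequence s_1, ..., s_n is a list of length n; lists are indexed from 0,
   so s_i is s ! (i - 1). *)
definition S :: "nat \<Rightarrow> int list set" where
  "S n =
     {s. length s = n \<and>
         (\<forall>i. 1 \<le> i \<and> i \<le> n \<longrightarrow> 1 \<le> s ! (i - 1) \<and> s ! (i - 1) \<le> int i) \<and>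
         (\<forall>i j. 1 \<le> i \<and> i \<le> n \<and> s ! (i - 1) = j \<longrightarrow>
            (\<forall>r::nat. 1 \<le> r \<and> int r \<le> j - 1 \<longrightarrow> s ! (i - r - 1) \<le> j - int r))}"

lemma block_of_eqI:
  assumes "partition_on A \<pi>" "B \<in> \<pi>" "i \<in> B"
  shows "block_of \<pi> i = B"
  unfolding block_of_def
proof (rule the_equality)
  fix C assume "C \<in> \<pi> \<and> i \<in> C"
  then show "C = B"
    using assms partition_onD2[OF assms(1)] by (auto dest: disjointD)
qed (use assms in auto)

lemma finite_block:
  assumes "partition_on {1..2*n+1::nat} \<pi>" "B \<in> \<pi>"
  shows "finite B"
proof (rule finite_subset)
  show "B \<subseteq> {1..2*n+1}" using Sup_upper[OF assms(2)] partition_onD1[OF assms(1)] by blast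
qed simp

text \<open>In a special partition, \<open>i\<close> is not the maximum of its block if and only if
  \<open>i + 1\<close> is the minimum of its block.\<close>

lemma Suc_Min_block:
  assumes "\<pi> \<in> special_partitions n" "B \<in> \<pi>" "C \<in> \<pi>" "i \<in> B" "i \<noteq> Max B" "i + 1 \<in> C"
  shows "i + 1 = Min C"
proof -
  have P: "partition_on {1..2*n+1} \<pi>" and nc: "noncrossing \<pi>"
    and cons: "\<And>B x. B \<in> \<pi> \<Longrightarrow> x \<in> B \<Longrightarrow> x + 1 \<notin> B"
    using assms(1) by (auto simp: special_partitions_def)
  have fin: "finite B" "finite C"
    using finite_block[OF P] assms(2,3) by blast+
  have "Max B \<in> B" using Max_in[OF fin(1)] assms(4) by blast
  have "i < Max B" using Max_ge[OF fin(1) assms(4)] assms(5) by simp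
  have ne: "i \<notin> C" "B \<noteq> C"
    using cons assms(2,3,4,6) by auto
  have "Max B \<noteq> i + 1"
    using \<open>Max B \<in> B\<close> cons[OF assms(2,4)] by metis
  then have "i + 1 < Max B"
    using \<open>i < Max B\<close> by linarith
  have "i + 1 \<le> c" if "c \<in> C" for c
  proof (rule ccontr)
    assume "\<not> i + 1 \<le> c"
    moreover have "c \<noteq> i" using ne that by blast
    ultimately have "c < i \<and> i < i + 1 \<and> i + 1 < Max B \<and> c \<in> C \<and> i + 1 \<in> C \<and> i \<in> B \<and> Max B \<in> B"
      using \<open>i + 1 < Max B\<close> \<open>Max B \<in> B\<close> that assms(4,6) by simp
    then have "C = B" using nc assms(2,3) unfolding noncrossing_def by blast
    then show False using ne by simp
  qed
  then show ?thesis using fin assms(6) by (metis Min_eqI)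
qed

lemma Suc_Min_block_converse:
  assumes "\<pi> \<in> special_partitions n" "B \<in> \<pi>" "C \<in> \<pi>" "i \<in> B" "i + 1 \<in> C" "i + 1 = Min C"
  shows "i \<noteq> Max B"
proof -
  have P: "partition_on {1..2*n+1} \<pi>" and k: "card \<pi> = n + 1"
    using assms(1) by (auto simp: special_partitions_def)
  have U: "\<Union>\<pi> = {1..2*n+1}" using partition_onD1[OF P] by (rule sym)
  have fin: "finite B" "B \<noteq> {}" "Max B \<in> B" "Min B \<in> B" if "B \<in> \<pi>" for B
  proof -
    show 1: "finite B" using finite_block[OF P that] .
    show 2: "B \<noteq> {}" using that P by (auto simp: partition_on_def)
    show "Max B \<in> B" "Min B \<in> B" using 1 2 by auto
  qed
  have uniq: "B = C" if "B \<in> \<pi>" "C \<in> \<pi>" "x \<in> B" "x \<in> C" for B C x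
    using that block_of_eqI[OF P] by metis
  define N where "N = {1..2*n+1} - Max ` \<pi>"
  define M where "M = Min ` \<pi> - {1}"
  have "inj_on Max \<pi>" "inj_on Min \<pi>" using fin uniq by (metis inj_onI)+
  then have cM: "card (Max ` \<pi>) = n + 1" "card (Min ` \<pi>) = n + 1"
    using k by (auto simp: card_image)
  have finpi: "finite \<pi>" using k card.infinite by fastforce
  have "Max ` \<pi> \<subseteq> {1..2*n+1}" using fin U by blast
  then have cN: "card N = n" using cM finpi by (simp add: N_def card_Diff_subset)
  obtain D where D: "D \<in> \<pi>" "1 \<in> D" using U by (metis UnionE atLeastAtMost_iff le_add2 order_refl)
  then have "Min D = 1" using fin U
    by (metis Min_eqI UnionI atLeastAtMost_iff)
  then have "1 \<in> Min ` \<pi>" using D by force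
  then have cM': "card M = n" using cM finpi by (simp add: M_def)
  have sub: "Suc ` N \<subseteq> M"
  proof
    fix y assume "y \<in> Suc ` N"
    then obtain x where x: "x \<in> N" "y = Suc x" by auto
    obtain B' where B': "B' \<in> \<pi>" "x \<in> B'" using x U unfolding N_def by (metis DiffD1 UnionE)
    have nm: "x \<noteq> Max B'" using x B' by (auto simp: N_def)
    then have "x < Max B'" using Max_ge[OF fin(1)[OF B'(1)] B'(2)] by simp
    moreover have "Max B' \<le> 2*n+1" using fin(3)[OF B'(1)] B' U by auto
    ultimately have "x + 1 \<in> \<Union>\<pi>" by (simp add: U)
    then obtain C' where C': "C' \<in> \<pi>" "x + 1 \<in> C'" by auto
    have "x + 1 = Min C'" using Suc_Min_block[OF assms(1) B'(1) C'(1) B'(2) nm C'(2)] .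
    moreover have "x \<ge> 1" using x by (auto simp: N_def)
    ultimately show "y \<in> M" using x C' by (auto simp: M_def)
  qed
  have "finite M" using finpi by (simp add: M_def)
  then have "Suc ` N = M" using sub cN cM' by (simp add: card_image card_subset_eq)
  moreover have "i \<in> \<Union>\<pi>" using assms(2,4) by blast
  then have "i + 1 \<in> M"
    using assms(3,6) U by (auto simp: M_def)
  ultimately have "i \<in> N" by auto
  then show ?thesis using assms by (auto simp: N_def)
qed

lemma special_partition_parity:
  assumes "\<pi> \<in> special_partitions n" "B \<in> \<pi>" "i \<in> B" "i' \<in> B" "i < i'"
  shows "even (i' - i)"
  using assms(2-)
proof (induction "i' - i" arbitrary: B i i' rule: less_induct)
  case less
  have P: "partition_on {1..2*n+1} \<pi>" and nc: "noncrossing \<pi>"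
    and cons: "\<And>B x. B \<in> \<pi> \<Longrightarrow> x \<in> B \<Longrightarrow> x + 1 \<notin> B"
    using assms(1) by (auto simp: special_partitions_def)
  have U: "\<Union>\<pi> = {1..2*n+1}" using partition_onD1[OF P] by (rule sym)
  have fin: "finite B" "Max B \<in> B" "Min B \<in> B" if "B \<in> \<pi>" for B
  proof -
    show 1: "finite B" using finite_block[OF P that] .
    have 2: "B \<noteq> {}" using that P by (auto simp: partition_on_def)
    show "Max B \<in> B" "Min B \<in> B" using 1 2 by auto
  qed
  have uniq: "B = C" if "B \<in> \<pi>" "C \<in> \<pi>" "x \<in> B" "x \<in> C" for B C x
    using that block_of_eqI[OF P] by metis
  have ncD: "B = C" if "B \<in> \<pi>" "C \<in> \<pi>" "a < b" "b < c" "c < d" "a \<in> B" "c \<in> B" "b \<in> C" "d \<in> C"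
    for B C a b c d
    using nc that unfolding noncrossing_def by blast
  show ?case
  proof (cases "\<exists>k\<in>B. i < k \<and> k < i'")
    case True
    then obtain k where k: "k \<in> B" "i < k" "k < i'" by auto
    have "even (k - i)" "even (i' - k)"
      using less(1)[of k i B] less(1)[of i' k B] less.prems k by auto
    moreover have "i' - i = (i' - k) + (k - i)" using k by simp
    ultimately show ?thesis by (metis even_add)
  next
    case False
    have range: "1 \<le> x" "x \<le> 2*n+1" if "x \<in> B" for x using that less.prems U by auto
    have "i + 1 < i'" using less.prems cons by (metis Suc_eq_plus1 Suc_lessI)
    then obtain C where C: "C \<in> \<pi>" "i + 1 \<in> C"
      using U range less.prems by (metis (no_types) UnionE atLeastAtMost_iff le_add2 less_imp_le_nat order_trans)
    have "B \<noteq> C" using cons C less.prems by blast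
    have nm: "i \<noteq> Max B" using less.prems fin by (metis Max_ge not_le)
    have mC: "i + 1 = Min C"
      using Suc_Min_block[OF assms(1) less.prems(1) C(1) less.prems(2) nm C(2)] .
    define m where "m = Max C"
    have m: "m \<in> C" "i + 1 \<le> m" using fin[OF C(1)] C by (auto simp: m_def)
    have "m < i'"
    proof (rule ccontr)
      assume "\<not> m < i'"
      moreover have "m \<noteq> i'" using uniq[OF less.prems(1) C(1)] less.prems m \<open>B \<noteq> C\<close> by auto
      ultimately have "i' < m" by simp
      then show False
        using ncD[OF less.prems(1) C(1), of i "i+1" i' m] \<open>i + 1 < i'\<close> less.prems C m \<open>B \<noteq> C\<close>
        by auto
    qed
    have "m + 1 = i'"
    proof (rule ccontr)
      assume "m + 1 \<noteq> i'"
      then have lt: "m + 1 < i'" using \<open>m < i'\<close> by simp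
      then obtain D where D: "D \<in> \<pi>" "m + 1 \<in> D"
        using U range less.prems by (metis (no_types) UnionE atLeastAtMost_iff le_add2 less_imp_le_nat order_trans)
      have "m + 1 \<noteq> Min D"
        using Suc_Min_block_converse[OF assms(1) C(1) D(1) m(1) D(2)] m_def by blast
      define p where "p = Min D"
      have p: "p \<in> D" "p < m + 1"
        using fin[OF D(1)] D \<open>m + 1 \<noteq> Min D\<close> by (auto simp: p_def le_neq_implies_less)
      have "D \<noteq> C"
        using D fin[OF C(1)] by (metis Max_ge Suc_eq_plus1 Suc_n_not_le_n m_def)
      have "D \<noteq> B" using False D lt m by force
      have "p \<noteq> i + 1" "p \<noteq> m" "p \<noteq> i"
        using uniq[OF D(1) C(1)] uniq[OF D(1) less.prems(1)] p C m less.prems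
          \<open>D \<noteq> C\<close> \<open>D \<noteq> B\<close> by auto
      then consider "p < i" | "i + 1 < p" "p < m" using p by linarith
      then show False
      proof cases
        case 1
        then show False
          using ncD[OF D(1) less.prems(1), of p i "m+1" i'] p D less.prems lt m \<open>D \<noteq> B\<close> by auto
      next
        case 2
        then show False
          using ncD[OF C(1) D(1), of "i+1" p m "m+1"] p D C m \<open>D \<noteq> C\<close> by auto
      qed
    qed
    have "even (m - (i + 1))"
    proof (cases "i + 1 = m")
      case False
      then show ?thesis
        using less(1)[of m "i+1" C] C m \<open>m < i'\<close> by auto
    qed simp
    moreover have "i' - i = (m - (i + 1)) + 2" using \<open>m + 1 = i'\<close> m by simp
    ultimately show ?thesis by simp
  qed
qed

lemma difference_even:
  assumes "\<pi> \<in> special_partitions n" "i \<in> {1..2*n+1}"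
  shows "even (difference \<pi> i)"
proof -
  have P: "partition_on {1..2*n+1} \<pi>" using assms by (auto simp: special_partitions_def)
  then obtain B where B: "B \<in> \<pi>" "i \<in> B" using assms(2) partition_onD1[OF P] by (metis UnionE)
  have "finite B" using finite_block[OF P B(1)] .
  show ?thesis
  proof (cases "i = Max B")
    case False
    let ?i' = "Min {i'\<in>B. i < i'}"
    have "Max B \<in> {i'\<in>B. i < i'}"
      using False B \<open>finite B\<close> by (metis (lifting) Max_ge Max_in empty_iff le_neq_implies_less mem_Collect_eq)
    then have "?i' \<in> {i'\<in>B. i < i'}"
      using \<open>finite B\<close> by (intro Min_in) auto
    then have "even (?i' - i)" "i \<le> ?i'"
      using special_partition_parity[OF assms(1) B(1,2)] by auto
    then show ?thesis
      using False block_of_eqI[OF P B] by (simp add: difference_def Let_def)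
  next
    case True
    then show ?thesis using block_of_eqI[OF P B] by (simp add: difference_def Let_def)
  qed
qed

end

theory Submission
  imports Defs
begin

text \<open>
  A special partition is the contour walk of a plane tree with \<open>n\<close> edges: the blocks are the
  vertices, and the elements of a block are the times at which the walk stands at that vertex.
  A time \<open>i\<close> that is not maximal in its block is followed by the first visit to a new child (this
  is what the lemmas \<open>Suc_Min_block\<close> and \<open>Suc_Min_block_converse\<close> say), and the difference at \<open>i\<close>
  is the time until the walk is back from that child, so twice the number of vertices of the
  child's subtree. Hence \<open>f\<close> lists, backwards, the subtree sizes of all vertices other than the
  root in preorder; and \<open>S n\<close> consists of the reversed lists in which the intervals
  \<open>k, \<dots>, k + b\<^sub>k - 1\<close> fit into each other like the preorder intervals of subtrees.

  The proof does not construct the trees. It treats the nonzero differences as arcs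
  from \<open>i\<close> to \<open>i + gap i\<close>, and needs three facts.

  \<^item> The values lie in \<open>S n\<close>: arcs are nested (\<open>gaps_nested\<close>), and an arc of length \<open>2 * b\<close>
    covers exactly \<open>b\<close> starting points of arcs (\<open>gap_eq_twice_card\<close>), since starting points and
    arc ends, moved back by one, are matched like parentheses. Thus nesting of arcs on the
    line becomes nesting of index intervals (\<open>nested_half_gaps\<close>).

  \<^item> Injectivity: by \<open>gap_eq_0_iff_end\<close>, the earlier differences decide whether the difference at
    \<open>i\<close> vanishes. If it does not, it is the next unused entry of the list of nonzero
    differences. So all differences can be read off from left to right (\<open>gap_eqI\<close>), and they
    determine the blocks.

  \<^item> Surjectivity: a nested list \<open>h # c\<close> splits into the list of the first subtree, of
    length \<open>h - 1\<close>, and the list of the remaining forest. Partitions realizing these two are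
    placed side by side and joined to a new first point by \<open>graft\<close>
    (\<open>nested_realizable\<close>).
\<close>

section \<open>Differences as arcs\<close>

definition gap :: "nat set set \<Rightarrow> nat \<Rightarrow> nat" where
  "gap \<pi> i = nat (difference \<pi> i)"

lemma block_of_props:
  assumes "partition_on A \<pi>" "i \<in> A"
  shows "block_of \<pi> i \<in> \<pi>" "i \<in> block_of \<pi> i"
proof -
  obtain B where "B \<in> \<pi>" "i \<in> B" using assms partition_onD1 by blast
  then show "block_of \<pi> i \<in> \<pi>" "i \<in> block_of \<pi> i"
    using block_of_eqI[OF assms(1)] by auto
qed

lemma gap_to_successor:
  assumes "finite (block_of \<pi> i)" "i \<in> block_of \<pi> i"
  shows "difference \<pi> i = int (gap \<pi> i)"
    and "gap \<pi> i = 0 \<longleftrightarrow> i = Max (block_of \<pi> i)"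
    and "gap \<pi> i > 0 \<Longrightarrow> i + gap \<pi> i \<in> block_of \<pi> i"
    and "k \<in> block_of \<pi> i \<Longrightarrow> i < k \<Longrightarrow> gap \<pi> i > 0 \<and> i + gap \<pi> i \<le> k"
proof -
  let ?B = "block_of \<pi> i" and ?L = "{j \<in> block_of \<pi> i. i < j}"
  have fin: "finite ?L" using assms by simp
  have max: "i = Max ?B \<longleftrightarrow> ?L = {}"
  proof
    assume "i = Max ?B"
    then show "?L = {}" using Max_ge[OF assms(1)] by (auto dest: leD intro: leI)
  next
    assume "?L = {}"
    then show "i = Max ?B" using assms by (intro Max_eqI[symmetric]) (auto dest: leD intro: leI)
  qed
  have Min: "Min ?L \<in> ?L" if "?L \<noteq> {}" using Min_in[OF fin that] .
  show *: "difference \<pi> i = int (gap \<pi> i)"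
  proof (cases "i = Max ?B")
    case False
    then show ?thesis using max Min by (simp add: gap_def difference_def Let_def)
  qed (simp add: gap_def difference_def Let_def)
  have pos: "gap \<pi> i = Min ?L - i" if "?L \<noteq> {}"
  proof -
    have "difference \<pi> i = int (Min ?L) - int i"
      using max that unfolding difference_def Let_def by (simp only: if_False)
    then show ?thesis using * by linarith
  qed
  show zero: "gap \<pi> i = 0 \<longleftrightarrow> i = Max ?B"
  proof (cases "i = Max ?B")
    case False
    then show ?thesis using max Min pos by simp
  qed (simp add: gap_def difference_def Let_def)
  show "i + gap \<pi> i \<in> ?B" if "gap \<pi> i > 0"
  proof -
    have "?L \<noteq> {}" using that zero max by auto
    then show ?thesis using Min pos by simp
  qed
  show "gap \<pi> i > 0 \<and> i + gap \<pi> i \<le> k" if "k \<in> ?B" "i < k"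
  proof -
    have k: "k \<in> ?L" using that by simp
    then have "?L \<noteq> {}" by blast
    then show ?thesis using Min pos Min_le[OF fin k] by simp
  qed
qed

context
  fixes n :: nat and \<pi> :: "nat set set"
  assumes special: "\<pi> \<in> special_partitions n"
begin

lemma special_partition_on: "partition_on {1..2*n+1} \<pi>"
  using special by (simp add: special_partitions_def)

lemma block_of_special:
  assumes "i \<in> {1..2*n+1}"
  shows "block_of \<pi> i \<in> \<pi>" "i \<in> block_of \<pi> i" "finite (block_of \<pi> i)"
    "block_of \<pi> i \<subseteq> {1..2*n+1}"
proof -
  show B: "block_of \<pi> i \<in> \<pi>" "i \<in> block_of \<pi> i"
    using block_of_props[OF special_partition_on assms] .
  show "finite (block_of \<pi> i)" using finite_block[OF special_partition_on B(1)] .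
  show "block_of \<pi> i \<subseteq> {1..2*n+1}" using B(1) partition_onD1[OF special_partition_on] by blast
qed

lemma block_of_cong:
  assumes "i \<in> {1..2*n+1}" "j \<in> block_of \<pi> i"
  shows "block_of \<pi> j = block_of \<pi> i"
  using block_of_eqI[OF special_partition_on block_of_special(1)[OF assms(1)] assms(2)] .

lemma noncrossing_special:
  assumes "i \<in> {1..2*n+1}" "j \<in> {1..2*n+1}" "i < j" "j < k" "k < l"
    "k \<in> block_of \<pi> i" "l \<in> block_of \<pi> j"
  shows "block_of \<pi> i = block_of \<pi> j"
proof -
  have "noncrossing \<pi>" using special by (simp add: special_partitions_def)
  then show ?thesis
    unfolding noncrossing_def
    using block_of_special(1,2)[OF assms(1)] block_of_special(1,2)[OF assms(2)] assms(3-) by meson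
qed

lemma
  assumes "i \<in> {1..2*n+1}"
  shows difference_gap: "difference \<pi> i = int (gap \<pi> i)"
    and gap_eq_0_iff: "gap \<pi> i = 0 \<longleftrightarrow> i = Max (block_of \<pi> i)"
    and gap_in_block: "gap \<pi> i > 0 \<Longrightarrow> i + gap \<pi> i \<in> block_of \<pi> i"
    and gap_least: "k \<in> block_of \<pi> i \<Longrightarrow> i < k \<Longrightarrow> gap \<pi> i > 0 \<and> i + gap \<pi> i \<le> k"
  using gap_to_successor[OF block_of_special(3)[OF assms] block_of_special(2)[OF assms]] by blast+

lemma gap_range:
  assumes "i \<in> {1..2*n+1}" shows "i + gap \<pi> i \<le> 2*n+1"
proof (cases "gap \<pi> i = 0")
  case False
  then show ?thesis using gap_in_block[OF assms] block_of_special(4)[OF assms] by auto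
qed (use assms in auto)

lemma gap_neq_1:
  assumes "i \<in> {1..2*n+1}" shows "gap \<pi> i \<noteq> 1"
proof
  assume "gap \<pi> i = 1"
  then have "i + 1 \<in> block_of \<pi> i" using gap_in_block[OF assms] by simp
  then show False using special block_of_special(1,2)[OF assms] by (auto simp: special_partitions_def)
qed

text \<open>
  Arcs with a common end have their starting points in one block, and the end is the immediate
  successor in that block of only one element.
\<close>

lemma gap_end_inj:
  assumes "i \<in> {1..2*n+1}" "j \<in> {1..2*n+1}" "gap \<pi> i > 0" "gap \<pi> j > 0"
    "i + gap \<pi> i = j + gap \<pi> j"
  shows "i = j"
proof -
  have "False" if "i \<in> {1..2*n+1}" "j \<in> {1..2*n+1}" "gap \<pi> i > 0" "gap \<pi> j > 0"
    "i + gap \<pi> i = j + gap \<pi> j" "i < j" for i j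
  proof -
    have "block_of \<pi> i = block_of \<pi> j"
      using block_of_cong[OF that(1) gap_in_block[OF that(1,3)]]
        block_of_cong[OF that(2) gap_in_block[OF that(2,4)]] that(5) by simp
    then have "i + gap \<pi> i \<le> j" using gap_least[OF that(1) _ that(6)] block_of_special(2)[OF that(2)] by simp
    then show False using that by simp
  qed
  then show ?thesis using assms by (metis linorder_neqE_nat)
qed

text \<open>
  Two overlapping arcs that are not nested would be a crossing, unless they belong to the same
  block; but no element of a block lies strictly below an arc of that block.
\<close>

lemma gaps_nested:
  assumes "i \<in> {1..2*n+1}" "j \<in> {1..2*n+1}" "i \<le> j" "j < i + gap \<pi> i"
  shows "j + gap \<pi> j \<le> i + gap \<pi> i"
proof (rule ccontr)
  assume *: "\<not> ?thesis"
  then have "i < j" using assms(3) by (cases "i = j") auto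
  have "gap \<pi> i > 0" "gap \<pi> j > 0" using assms * by auto
  then have "block_of \<pi> i = block_of \<pi> j"
    using noncrossing_special[OF assms(1,2) \<open>i < j\<close> assms(4) _ gap_in_block[OF assms(1)] gap_in_block[OF assms(2)]]
      * by simp
  then have "i + gap \<pi> i \<le> j"
    using gap_least[OF assms(1) _ \<open>i < j\<close>] block_of_special(2)[OF assms(2)] by simp
  then show False using assms by simp
qed

text \<open>
  The walk turns back after time \<open>i\<close> exactly when \<open>i + 1\<close> is a return to a vertex, that is, when
  \<open>i + 1\<close> is not the minimum of its block. The returns are the ends of arcs. Only earlier
  differences occur on the right, which is what makes the sequence of differences
  recoverable from left to right.
\<close>

lemma gap_eq_0_iff_end:
  assumes "i \<in> {1..2*n}"
  shows "gap \<pi> i = 0 \<longleftrightarrow> (\<exists>m\<in>{1..<i}. gap \<pi> m > 0 \<and> m + gap \<pi> m = i + 1)"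
proof -
  have i: "i \<in> {1..2*n+1}" "i + 1 \<in> {1..2*n+1}" using assms by auto
  note B = block_of_special[OF i(1)] and C = block_of_special[OF i(2)]
  have eq: "gap \<pi> i = 0 \<longleftrightarrow> i + 1 \<noteq> Min (block_of \<pi> (i + 1))"
    using gap_eq_0_iff[OF i(1)] Suc_Min_block[OF special B(1) C(1) B(2) _ C(2)]
      Suc_Min_block_converse[OF special B(1) C(1) B(2) C(2)] by blast
  show ?thesis
  proof
    assume "gap \<pi> i = 0"
    then have ne: "i + 1 \<noteq> Min (block_of \<pi> (i + 1))" using eq by simp
    let ?L = "{x \<in> block_of \<pi> (i + 1). x < i + 1}"
    have "?L \<noteq> {}"
    proof
      assume "?L = {}"
      then have "Min (block_of \<pi> (i + 1)) = i + 1"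
        using C by (intro Min_eqI) (auto dest: leD intro: leI)
      then show False using ne by simp
    qed
    then have L: "Max ?L \<in> ?L" using C(3) by (intro Max_in) auto
    define m where "m = Max ?L"
    have m: "m \<in> block_of \<pi> (i + 1)" "m < i + 1" using L by (auto simp: m_def)
    have mr: "m \<in> {1..2*n+1}" using m C(4) by blast
    have bm: "block_of \<pi> m = block_of \<pi> (i + 1)" using block_of_cong[OF i(2) m(1)] .
    have 1: "gap \<pi> m > 0" "m + gap \<pi> m \<le> i + 1"
      using gap_least[OF mr _ m(2)] C(2) bm by auto
    have "m + gap \<pi> m = i + 1"
    proof (rule ccontr)
      assume "\<not> ?thesis"
      then have "m + gap \<pi> m \<in> ?L" using 1 gap_in_block[OF mr 1(1)] bm by simp
      then have "m + gap \<pi> m \<le> m" unfolding m_def using C(3) by (intro Max_ge) auto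
      then show False using 1 by simp
    qed
    then show "\<exists>m\<in>{1..<i}. gap \<pi> m > 0 \<and> m + gap \<pi> m = i + 1"
      using 1 mr gap_neq_1[OF mr] by (intro bexI[of _ m]) auto
  next
    assume "\<exists>m\<in>{1..<i}. gap \<pi> m > 0 \<and> m + gap \<pi> m = i + 1"
    then obtain m where m: "m \<in> {1..<i}" "gap \<pi> m > 0" "m + gap \<pi> m = i + 1" by auto
    have mr: "m \<in> {1..2*n+1}" using m i by auto
    have "block_of \<pi> m = block_of \<pi> (i + 1)"
      using block_of_cong[OF mr gap_in_block[OF mr m(2)]] m by simp
    then have "m \<in> block_of \<pi> (i + 1)" using block_of_special[OF mr] by simp
    then have "Min (block_of \<pi> (i + 1)) \<le> m" using C(3) by simp
    then show "gap \<pi> i = 0" using eq m by auto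
  qed
qed

lemma gap_last: "gap \<pi> (2*n+1) = 0"
  using gap_range[of "2*n+1"] by simp

text \<open>
  Below an arc, \<open>m \<mapsto> m + gap m - 1\<close> matches the starting points of arcs with the points of
  difference zero, like opening and closing parentheses; so each kind makes up half of the length.
\<close>

lemma gap_eq_twice_card:
  assumes "i \<in> {1..2*n+1}"
  shows "gap \<pi> i = 2 * card {m \<in> {i..<i + gap \<pi> i}. gap \<pi> m > 0}"
proof -
  let ?O = "{m \<in> {i..<i + gap \<pi> i}. gap \<pi> m > 0}"
  let ?Z = "{m \<in> {i..<i + gap \<pi> i}. gap \<pi> m = 0}"
  let ?g = "\<lambda>m. m + gap \<pi> m - 1"
  have r: "m \<in> {1..2*n}" "m \<in> {1..2*n+1}" if "m \<in> {i..<i + gap \<pi> i}" for m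
    using that gap_range[OF assms] assms by auto
  have "bij_betw ?g ?O ?Z"
    unfolding bij_betw_def
  proof
    show "inj_on ?g ?O"
    proof (rule inj_onI)
      fix x y assume "x \<in> ?O" "y \<in> ?O" "?g x = ?g y"
      then show "x = y" using r gap_end_inj[of x y] by auto
    qed
    show "?g ` ?O = ?Z"
    proof (intro set_eqI iffI)
      fix x assume "x \<in> ?g ` ?O"
      then obtain m where m: "m \<in> ?O" "x = ?g m" by auto
      have mi: "m \<in> {i..<i + gap \<pi> i}" "gap \<pi> m > 0" using m by auto
      have "gap \<pi> m > 1" using mi(2) gap_neq_1[OF r(2)[OF mi(1)]] by linarith
      moreover have "m + gap \<pi> m \<le> i + gap \<pi> i" using gaps_nested[OF assms r(2)[OF mi(1)]] mi by simp
      ultimately have x: "x \<in> {i..<i + gap \<pi> i}" "m < x" "m + gap \<pi> m = x + 1" using m mi by auto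
      have "m \<in> {1..<x}" using r(1)[OF mi(1)] x(2) by simp
      then have "gap \<pi> x = 0" using gap_eq_0_iff_end[OF r(1)[OF x(1)]] x(3) mi(2) by blast
      then show "x \<in> ?Z" using x by simp
    next
      fix x assume x: "x \<in> ?Z"
      then have xr: "x \<in> {1..2*n}" using r(1)[of x] by simp
      then obtain m where m: "m \<in> {1..<x}" "gap \<pi> m > 0" "m + gap \<pi> m = x + 1"
        using gap_eq_0_iff_end[OF xr] x by auto
      have mr: "m \<in> {1..2*n+1}" using m xr by auto
      have "i \<le> m"
      proof (rule ccontr)
        assume "\<not> i \<le> m"
        then have "i + gap \<pi> i \<le> m + gap \<pi> m" using gaps_nested[OF mr assms] m x by auto
        then have "i = m" using gap_end_inj[OF assms mr _ m(2)] m x by auto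
        then show False using \<open>\<not> i \<le> m\<close> by simp
      qed
      then show "x \<in> ?g ` ?O" using m x by (intro image_eqI[of _ _ m]) auto
    qed
  qed
  then have "card ?O = card ?Z" by (rule bij_betw_same_card)
  moreover have "card {i..<i + gap \<pi> i} = card ?O + card ?Z"
  proof -
    have "{i..<i + gap \<pi> i} = ?O \<union> ?Z" by auto
    moreover have "?O \<inter> ?Z = {}" by auto
    ultimately show ?thesis by (metis (lifting) card_Un_disjoint finite_Un finite_atLeastLessThan)
  qed
  ultimately show ?thesis by simp
qed

text \<open>Each of the \<open>n + 1\<close> blocks has one element that starts no arc, its maximum.\<close>

lemma card_openers: "card {i \<in> {1..2*n+1}. gap \<pi> i > 0} = n"
proof -
  let ?I = "{1..2*n+1}"
  have U: "\<Union>\<pi> = ?I" using partition_onD1[OF special_partition_on] by (rule sym)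
  have fin: "finite B" "Max B \<in> B" "block_of \<pi> (Max B) = B" if "B \<in> \<pi>" for B
  proof -
    show 1: "finite B" using finite_block[OF special_partition_on that] .
    have "B \<noteq> {}" using that partition_onD3[OF special_partition_on] by auto
    then show 2: "Max B \<in> B" using 1 by simp
    show "block_of \<pi> (Max B) = B" using block_of_eqI[OF special_partition_on that 2] .
  qed
  have inj: "inj_on Max \<pi>" by (rule inj_onI) (metis fin(3))
  have Max_in_I: "Max B \<in> ?I" if "B \<in> \<pi>" for B using fin(2)[OF that] that U by blast
  have "{i \<in> ?I. gap \<pi> i > 0} = ?I - Max ` \<pi>"
  proof (intro set_eqI iffI)
    fix i assume i: "i \<in> {i \<in> ?I. gap \<pi> i > 0}"
    then have "i \<noteq> Max (block_of \<pi> i)" using gap_eq_0_iff[of i] by auto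
    then show "i \<in> ?I - Max ` \<pi>" using i fin(3) by auto
  next
    fix i assume i: "i \<in> ?I - Max ` \<pi>"
    then have "i \<noteq> Max (block_of \<pi> i)" using block_of_special(1)[of i] by blast
    then show "i \<in> {i \<in> ?I. gap \<pi> i > 0}" using i gap_eq_0_iff[of i] by auto
  qed
  moreover have "Max ` \<pi> \<subseteq> ?I" using Max_in_I by blast
  moreover have "card (Max ` \<pi>) = n + 1" using special card_image[OF inj] by (simp add: special_partitions_def)
  ultimately show ?thesis by (simp add: card_Diff_subset finite_subset)
qed

end

section \<open>Membership in the target set\<close>

definition half_gaps :: "nat \<Rightarrow> nat set set \<Rightarrow> nat list" where
  "half_gaps n \<pi> = map (\<lambda>i. gap \<pi> i div 2) (filter (\<lambda>i. gap \<pi> i > 0) [1..<2*n+2])"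

text \<open>
  These are the lists of subtree sizes of plane forests in preorder: the subtree of the vertex
  number \<open>k\<close> occupies the positions from \<open>k\<close> up to, but excluding, \<open>k + b ! k\<close>.
\<close>

definition nested :: "nat list \<Rightarrow> bool" where
  "nested b \<longleftrightarrow> (\<forall>k<length b. 0 < b ! k \<and> k + b ! k \<le> length b \<and>
     (\<forall>l. k \<le> l \<and> l < k + b ! k \<longrightarrow> l + b ! l \<le> k + b ! k))"

lemma card_filter_before_nth:
  fixes a c k :: nat
  assumes "k < length (filter P [a..<c])"
  shows "card {m \<in> {a..<filter P [a..<c] ! k}. P m} = k"
  using assms
proof (induction c)
  case (Suc c)
  have len: "card {m \<in> {a..<c}. P m} = length (filter P [a..<c])"
  proof -
    have "card (set (filter P [a..<c])) = length (filter P [a..<c])"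
      by (intro distinct_card) simp
    moreover have "set (filter P [a..<c]) = {m \<in> {a..<c}. P m}" by auto
    ultimately show ?thesis by simp
  qed
  show ?case
  proof (cases "k < length (filter P [a..<c])")
    case True
    moreover from this have "a \<le> c" by (cases "a \<le> c") auto
    ultimately show ?thesis using Suc.IH by (simp add: nth_append)
  next
    case False
    then have "k = length (filter P [a..<c])" "a \<le> c" "P c"
      using Suc.prems by (auto split: if_splits)
    then show ?thesis using len by (simp add: nth_append)
  qed
qed simp

text \<open>
  The entry at position \<open>i\<close> (counted from one) of the sequence is \<open>b ! (n - i)\<close>, so going back by \<open>r\<close> in the
  sequence means going forward by \<open>r\<close> in \<open>b\<close>. With \<open>k = n - i\<close>, the bound \<open>i\<close> on the entry says
  that the interval starting at \<open>k\<close> ends inside the list, and the bound \<open>j - r\<close> says that the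
  interval starting at \<open>k + r\<close> ends no later than the one starting at \<open>k\<close>.
\<close>

lemma S_eq_image: "S n = (\<lambda>b. rev (map int b)) ` {b. length b = n \<and> nested b}"
proof -
  have iff: "rev (map int b) \<in> S n \<longleftrightarrow> nested b" if len: "length b = n" for b
  proof
    have nth: "rev (map int b) ! (i - 1) = int (b ! (n - i))" if "1 \<le> i" "i \<le> n" for i
      using that len by (simp add: rev_nth)
    show "nested b" if S: "rev (map int b) \<in> S n"
      unfolding nested_def
    proof (intro allI impI conjI)
      fix k assume k: "k < length b"
      define i where "i = n - k"
      have i: "1 \<le> i" "i \<le> n" "n - i = k" using k len by (auto simp: i_def)
      have "1 \<le> int (b ! k)" and "int (b ! k) \<le> int i"
        using S i nth[OF i(1,2)] unfolding S_def by auto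
      then show "0 < b ! k" and le: "k + b ! k \<le> length b"
        using i k len by auto
      fix l assume l: "k \<le> l \<and> l < k + b ! k"
      show "l + b ! l \<le> k + b ! k"
      proof (cases "l = k")
        case False
        define r where "r = l - k"
        have r: "1 \<le> r" "int r \<le> int (b ! k) - 1" using l False by (auto simp: r_def)
        then have "rev (map int b) ! (i - r - 1) \<le> int (b ! k) - int r"
          using S i nth[OF i(1,2)] unfolding S_def by auto
        moreover have "1 \<le> i - r" "i - r \<le> n" "n - (i - r) = l"
          using r l le i k len by (auto simp: r_def)
        ultimately show ?thesis using nth[of "i - r"] l by (auto simp: r_def)
      qed simp
    qed
    show "rev (map int b) \<in> S n" if b: "nested b"
      unfolding S_def
    proof (intro CollectI conjI allI impI)
      show "length (rev (map int b)) = n" using len by simp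
      fix i assume i: "1 \<le> i \<and> i \<le> n"
      then have k: "n - i < length b" using len by simp
      have "0 < b ! (n - i)" "n - i + b ! (n - i) \<le> length b"
        using b k unfolding nested_def by blast+
      then show "1 \<le> rev (map int b) ! (i - 1)" "rev (map int b) ! (i - 1) \<le> int i"
        using nth[of i] i len by auto
    next
      fix i j and r :: nat
      assume i: "1 \<le> i \<and> i \<le> n \<and> rev (map int b) ! (i - 1) = j"
        and r: "1 \<le> r \<and> int r \<le> j - 1"
      define k where "k = n - i"
      have k: "k < length b" using len i by (simp add: k_def)
      have j: "j = int (b ! k)" using i nth[of i] by (simp add: k_def)
      have kb: "k + b ! k \<le> length b"
        and "\<And>l. k \<le> l \<Longrightarrow> l < k + b ! k \<Longrightarrow> l + b ! l \<le> k + b ! k"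
        using b k unfolding nested_def by blast+
      from this(2)[of "k + r"] have "k + r + b ! (k + r) \<le> k + b ! k" using r j by simp
      moreover have "1 \<le> i - r" "i - r \<le> n" "n - (i - r) = k + r"
        using r j kb i len by (auto simp: k_def)
      ultimately show "rev (map int b) ! (i - r - 1) \<le> j - int r"
        using nth[of "i - r"] j by simp
    qed
  qed
  show ?thesis
  proof (intro set_eqI iffI)
    fix s assume s: "s \<in> S n"
    have "x \<ge> 0" if "x \<in> set s" for x
    proof -
      have len: "length s = n" and pos: "\<And>i. 1 \<le> i \<Longrightarrow> i \<le> n \<Longrightarrow> 1 \<le> s ! (i - 1)"
        using s by (simp_all add: S_def)
      obtain k where k: "k < n" "x = s ! k" using \<open>x \<in> set s\<close> len by (metis in_set_conv_nth)
      have "1 \<le> s ! (Suc k - 1)" using pos[of "Suc k"] k(1) by simp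
      then show ?thesis using k by simp
    qed
    then have "map int (map nat (rev s)) = rev s" unfolding map_map by (intro map_idI) simp
    then have eq: "s = rev (map int (map nat (rev s)))" by simp
    moreover have "length (map nat (rev s)) = n" using s by (simp add: S_def)
    ultimately show "s \<in> (\<lambda>b. rev (map int b)) ` {b. length b = n \<and> nested b}"
      using s iff by (metis (mono_tags, lifting) image_eqI mem_Collect_eq)
  qed (use iff in blast)
qed

context
  fixes n :: nat and \<pi> :: "nat set set"
  assumes special: "\<pi> \<in> special_partitions n"
begin

lemma f_eq_half_gaps: "f n \<pi> = rev (map int (half_gaps n \<pi>))"
proof -
  have "map (difference \<pi>) [1..<2*n+2] = map (\<lambda>i. int (gap \<pi> i)) [1..<2*n+2]"
    using difference_gap[OF special] by (intro map_cong) auto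
  then have "f n \<pi> = map (\<lambda>d. d div 2) (rev (filter (\<lambda>d. d \<noteq> 0) (map (\<lambda>i. int (gap \<pi> i)) [1..<2*n+2])))"
    by (simp only: f_def difference_seq_def)
  then show ?thesis
    by (simp add: half_gaps_def filter_map rev_map o_def zdiv_int del: upt_Suc)
qed

text \<open>
  Let \<open>c y\<close> be the number of starting points of arcs before \<open>y\<close>. It is \<open>k\<close> at the \<open>k\<close>-th
  starting point, and, by the count below an arc, \<open>k + half_gaps n \<pi> ! k\<close> at the end of the \<open>k\<close>-th
  arc. As \<open>c\<close> is monotone, it carries nested arcs to nested index intervals.
\<close>

lemma nested_half_gaps: "nested (half_gaps n \<pi>)" "length (half_gaps n \<pi>) = n"
proof -
  define xs where "xs = filter (\<lambda>i. gap \<pi> i > 0) [1..<2*n+2]"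
  define c where "c y = card {m \<in> {1..<y}. gap \<pi> m > 0}" for y
  have c_mono: "c y \<le> c z" if "y \<le> z" for y z
    unfolding c_def using that by (intro card_mono) auto
  have c_last: "c (2*n+2) = n"
  proof -
    have "{1..<2*n+2} = {1..2*n+1}" by auto
    then show ?thesis using card_openers[OF special] by (simp only: c_def)
  qed
  have set_xs: "set xs = {m \<in> {1..<2*n+2}. gap \<pi> m > 0}" by (auto simp: xs_def simp del: upt_Suc)
  have "distinct xs" by (simp add: xs_def)
  then have len: "length xs = n"
    using c_last set_xs distinct_card[of xs] by (simp add: c_def)
  then show len': "length (half_gaps n \<pi>) = n" by (simp add: half_gaps_def xs_def)
  have c_nth: "c (xs ! k) = k" if "k < n" for k
    using card_filter_before_nth[of k "\<lambda>i. gap \<pi> i > 0" 1 "2*n+2"] that len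
    by (simp add: c_def xs_def)
  have xs: "xs ! k \<in> {1..2*n+1}" "gap \<pi> (xs ! k) > 0" if "k < n" for k
    using nth_mem[of k xs] that len set_xs by auto
  have hg: "half_gaps n \<pi> ! k = gap \<pi> (xs ! k) div 2" if "k < n" for k
    using that len by (simp add: half_gaps_def xs_def del: upt_Suc)
  have c_end: "c (xs ! k + gap \<pi> (xs ! k)) = k + half_gaps n \<pi> ! k" if k: "k < n" for k
  proof -
    let ?i = "xs ! k"
    let ?A = "{m \<in> {1..<?i}. gap \<pi> m > 0}"
    let ?B = "{m \<in> {?i..<?i + gap \<pi> ?i}. gap \<pi> m > 0}"
    have "{m \<in> {1..<?i + gap \<pi> ?i}. gap \<pi> m > 0} = ?A \<union> ?B"
      using xs[OF k] by auto
    then have "c (?i + gap \<pi> ?i) = card (?A \<union> ?B)"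
      unfolding c_def by (rule arg_cong)
    also have "\<dots> = card ?A + card ?B" by (rule card_Un_disjoint) auto
    finally have "c (?i + gap \<pi> ?i) = c ?i + card ?B" by (simp only: c_def)
    then show ?thesis
      using gap_eq_twice_card[OF special xs(1)[OF k]] c_nth[OF k] hg[OF k] by simp
  qed
  show "nested (half_gaps n \<pi>)"
    unfolding nested_def len'
  proof (intro allI impI conjI)
    fix k assume k: "k < n"
    let ?i = "xs ! k"
    show "0 < half_gaps n \<pi> ! k"
      using hg[OF k] xs(2)[OF k] gap_neq_1[OF special xs(1)[OF k]] by (simp add: div_greater_zero_iff)
    show le: "k + half_gaps n \<pi> ! k \<le> n"
      using c_end[OF k] c_mono[of "?i + gap \<pi> ?i" "2*n+2"] c_last
        gap_range[OF special xs(1)[OF k]] by simp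
    fix l assume l: "k \<le> l \<and> l < k + half_gaps n \<pi> ! k"
    then have ln: "l < n" using le by simp
    have "?i \<le> xs ! l"
    proof -
      have "sorted xs" by (simp add: xs_def sorted_wrt_filter del: upt_Suc)
      then show ?thesis using l ln len by (simp add: sorted_nth_mono)
    qed
    moreover have "xs ! l < ?i + gap \<pi> ?i"
    proof (rule ccontr)
      assume "\<not> ?thesis"
      then have "c (?i + gap \<pi> ?i) \<le> c (xs ! l)" by (intro c_mono) simp
      then show False using c_end[OF k] c_nth[OF ln] l by linarith
    qed
    ultimately have "xs ! l + gap \<pi> (xs ! l) \<le> ?i + gap \<pi> ?i"
      using gaps_nested[OF special xs(1)[OF k] xs(1)[OF ln]] by simp
    then show "l + half_gaps n \<pi> ! l \<le> k + half_gaps n \<pi> ! k"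
      using c_mono c_end[OF k] c_end[OF ln] by metis
  qed
qed

lemma filter_gaps_eq_half_gaps:
  "filter (\<lambda>d. d > 0) (map (gap \<pi>) [1..<2*n+2]) = map ((*) 2) (half_gaps n \<pi>)"
proof -
  have "even (gap \<pi> i)" if "i \<in> {1..2*n+1}" for i
    using gap_eq_twice_card[OF special that] by (metis dvd_triv_left)
  then show ?thesis
    unfolding half_gaps_def filter_map o_def map_map by (intro map_cong) (auto simp del: upt_Suc)
qed

end

section \<open>Injectivity\<close>

text \<open>
  If the differences before \<open>i\<close> agree, then both vanish at \<open>i\<close> or neither does; in the latter
  case both are the entry of the common list of nonzero differences that follows
  those coming from positions before \<open>i\<close>.
\<close>

lemma gap_eqI:
  assumes \<pi>: "\<pi> \<in> special_partitions n" and \<sigma>: "\<sigma> \<in> special_partitions n"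
    and eq: "half_gaps n \<pi> = half_gaps n \<sigma>" and "i \<in> {1..2*n+1}"
  shows "gap \<pi> i = gap \<sigma> i"
  using assms(4)
proof (induction i rule: less_induct)
  case (less i)
  have zero: "gap \<pi> i = 0 \<longleftrightarrow> gap \<sigma> i = 0"
  proof (cases "i = 2*n+1")
    case True
    then show ?thesis using gap_last[OF \<pi>] gap_last[OF \<sigma>] by simp
  next
    case False
    then have i: "i \<in> {1..2*n}" using less.prems by simp
    show ?thesis
      unfolding gap_eq_0_iff_end[OF \<pi> i] gap_eq_0_iff_end[OF \<sigma> i]
      using less i by (intro bex_cong) auto
  qed
  have "[1..<2*n+2] = [1..<i] @ i # [Suc i..<2*n+2]"
    using less.prems upt_add_eq_append[of 1 i "2*n+2-i"] upt_conv_Cons[of i "2*n+2"] by (simp del: upt_Suc)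
  moreover have "filter (\<lambda>d. d > 0) (map (gap \<pi>) [1..<i]) = filter (\<lambda>d. d > 0) (map (gap \<sigma>) [1..<i])"
    using less by (intro arg_cong[where f = "filter _"] map_cong) auto
  moreover have "filter (\<lambda>d. d > 0) (map (gap \<pi>) [1..<2*n+2]) = filter (\<lambda>d. d > 0) (map (gap \<sigma>) [1..<2*n+2])"
    using filter_gaps_eq_half_gaps[OF \<pi>] filter_gaps_eq_half_gaps[OF \<sigma>] eq by simp
  ultimately show ?case using zero by (simp del: upt_Suc split: if_splits)
qed

text \<open>Within a block, every larger element is reached by following arcs.\<close>

lemma block_of_mono_gap:
  assumes \<pi>: "\<pi> \<in> special_partitions n" and \<sigma>: "\<sigma> \<in> special_partitions n"
    and eq: "\<And>i. i \<in> {1..2*n+1} \<Longrightarrow> gap \<pi> i = gap \<sigma> i"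
    and "i \<in> {1..2*n+1}"
  shows "block_of \<pi> i \<subseteq> block_of \<sigma> i"
proof -
  have up: "block_of \<sigma> j = block_of \<sigma> i"
    if "i \<in> {1..2*n+1}" "j \<in> block_of \<pi> i" "i \<le> j" for i j
    using that
  proof (induction "j - i" arbitrary: i rule: less_induct)
    case less
    show ?case
    proof (cases "i = j")
      case False
      then have "i < j" using less.prems by simp
      then have g: "gap \<pi> i > 0" "i + gap \<pi> i \<le> j"
        using gap_least[OF \<pi> less.prems(1,2)] by auto
      let ?k = "i + gap \<pi> i"
      have k: "?k \<in> {1..2*n+1}" using gap_range[OF \<pi> less.prems(1)] less.prems by simp
      have "block_of \<pi> ?k = block_of \<pi> i"
        using block_of_cong[OF \<pi> less.prems(1) gap_in_block[OF \<pi> less.prems(1)]] g by simp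
      then have "block_of \<sigma> j = block_of \<sigma> ?k"
      proof (intro less.hyps k)
        show "j - ?k < j - i" "?k \<le> j" using g less.prems(2) by linarith+
        show "j \<in> block_of \<pi> ?k" using \<open>block_of \<pi> ?k = block_of \<pi> i\<close> less.prems(2) by simp
      qed
      also have "\<dots> = block_of \<sigma> i"
        using block_of_cong[OF \<sigma> less.prems(1) gap_in_block[OF \<sigma> less.prems(1)]] g eq[OF less.prems(1)]
        by simp
      finally show ?thesis .
    qed simp
  qed
  show ?thesis
  proof
    fix j assume j: "j \<in> block_of \<pi> i"
    have jr: "j \<in> {1..2*n+1}" using block_of_special(4)[OF \<pi> assms(4)] j by blast
    have "block_of \<sigma> j = block_of \<sigma> i"
    proof (cases "i \<le> j")
      case True
      then show ?thesis using up[OF assms(4) j] by simp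
    next
      case False
      have "i \<in> block_of \<pi> j"
        using block_of_cong[OF \<pi> assms(4) j] block_of_special(2)[OF \<pi> assms(4)] by simp
      then show ?thesis using up[OF jr] False by simp
    qed
    then show "j \<in> block_of \<sigma> i" using block_of_special(2)[OF \<sigma> jr] by simp
  qed
qed

lemma special_eq_image_block_of:
  assumes "\<pi> \<in> special_partitions n"
  shows "\<pi> = block_of \<pi> ` {1..2*n+1}"
proof (intro set_eqI iffI)
  note P = special_partition_on[OF assms]
  fix B assume B: "B \<in> \<pi>"
  then have "B \<noteq> {}" using partition_onD3[OF P] by auto
  then obtain i where i: "i \<in> B" by blast
  then have "i \<in> {1..2*n+1}" using B partition_onD1[OF P] by blast
  then show "B \<in> block_of \<pi> ` {1..2*n+1}" using block_of_eqI[OF P B i] by blast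
qed (use block_of_special(1)[OF assms] in auto)

lemma inj_on_half_gaps: "inj_on (half_gaps n) (special_partitions n)"
proof (rule inj_onI)
  fix \<pi> \<sigma> assume *: "\<pi> \<in> special_partitions n" "\<sigma> \<in> special_partitions n"
    "half_gaps n \<pi> = half_gaps n \<sigma>"
  note eq = gap_eqI[OF *]
  have "block_of \<pi> i = block_of \<sigma> i" if "i \<in> {1..2*n+1}" for i
    using block_of_mono_gap[OF *(1,2) eq that] block_of_mono_gap[OF *(2,1) eq[symmetric] that] by auto
  then have "block_of \<pi> ` {1..2*n+1} = block_of \<sigma> ` {1..2*n+1}" by (rule image_cong[OF refl])
  then show "\<pi> = \<sigma>" using special_eq_image_block_of *(1,2) by metis
qed

section \<open>Surjectivity\<close>

text \<open>
  The walk \<open>\<pi>\<close> around the first subtree takes the times between \<open>p\<close> and \<open>q\<close>, and the walk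
  \<open>\<sigma>\<close> around the remaining tree starts at time \<open>q\<close> at its root. The root is also
  visited at time \<open>p\<close>, before the walk enters the first subtree.
\<close>

definition graft :: "nat \<Rightarrow> nat set set \<Rightarrow> nat \<Rightarrow> nat set set \<Rightarrow> nat set set" where
  "graft p \<pi> q \<sigma> = \<pi> \<union> (\<lambda>B. if q \<in> B then insert p B else B) ` \<sigma>"

context
  fixes p q r :: nat and \<pi> \<sigma> :: "nat set set"
  assumes pq: "Suc p < q" and qr: "q \<le> r"
    and \<pi>: "partition_on {Suc p..<q} \<pi>" and \<sigma>: "partition_on {q..r} \<sigma>"
begin

private definition attach :: "nat set \<Rightarrow> nat set" where
  "attach B = (if q \<in> B then insert p B else B)"

private lemma attach_sub: "B \<subseteq> attach B" by (auto simp: attach_def)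

private lemma in_attach: "x \<in> attach B \<longleftrightarrow> x \<in> B \<or> x = p \<and> q \<in> B" by (auto simp: attach_def)

private lemma graft_attach: "graft p \<pi> q \<sigma> = \<pi> \<union> attach ` \<sigma>"
  by (auto simp: graft_def attach_def)

private lemma left_range: "B \<in> \<pi> \<Longrightarrow> x \<in> B \<Longrightarrow> p < x \<and> x < q"
  using partition_onD1[OF \<pi>] by (fastforce simp: Suc_le_eq)

private lemma right_range: "B \<in> \<sigma> \<Longrightarrow> x \<in> B \<Longrightarrow> q \<le> x \<and> x \<le> r"
  using partition_onD1[OF \<sigma>] by fastforce

private lemma attach_range: "B \<in> \<sigma> \<Longrightarrow> x \<in> attach B \<Longrightarrow> x = p \<or> q \<le> x"
  using right_range by (auto simp: in_attach)

private lemma attach_gt: "x \<in> attach B \<Longrightarrow> p < x \<Longrightarrow> x \<in> B"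
  by (auto simp: in_attach)

private lemma attach_eq_iff:
  assumes "B \<in> \<sigma>" "C \<in> \<sigma>" "x \<in> attach B" "x \<in> attach C" shows "B = C"
  using assms block_of_eqI[OF \<sigma>] by (metis in_attach pq right_range not_less less_SucI less_imp_le Suc_lessD)

lemma partition_on_graft: "partition_on {p..r} (graft p \<pi> q \<sigma>)"
proof (rule partition_onI)
  have "\<Union>(attach ` \<sigma>) = insert p {q..r}"
    using partition_onD1[OF \<sigma>] qr by (auto simp: attach_def split: if_splits)
  then show "\<Union>(graft p \<pi> q \<sigma>) = {p..r}"
    using partition_onD1[OF \<pi>, symmetric] pq qr by (simp only: graft_attach Union_Un_distrib) auto
  show "{} \<notin> graft p \<pi> q \<sigma>"
    using partition_onD3[OF \<pi>] partition_onD3[OF \<sigma>] by (auto simp: graft_attach attach_def)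
  fix B C assume "B \<in> graft p \<pi> q \<sigma>" "C \<in> graft p \<pi> q \<sigma>" "B \<noteq> C"
  then consider "B \<in> \<pi>" "C \<in> \<pi>" | C' where "B \<in> \<pi>" "C = attach C'" "C' \<in> \<sigma>"
    | B' where "B = attach B'" "B' \<in> \<sigma>" "C \<in> \<pi>"
    | B' C' where "B = attach B'" "B' \<in> \<sigma>" "C = attach C'" "C' \<in> \<sigma>"
    by (auto simp: graft_attach)
  then show "disjnt B C"
  proof cases
    case 1
    then show ?thesis using partition_onD2[OF \<pi>] \<open>B \<noteq> C\<close> by (auto simp: disjnt_def dest: disjointD)
  next
    case 2
    then show ?thesis using left_range[of B] attach_range[of C'] by (fastforce simp: disjnt_iff)
  next
    case 3
    then show ?thesis using left_range[of C] attach_range[of B'] by (fastforce simp: disjnt_iff)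
  next
    case 4
    then show ?thesis using attach_eq_iff[of B' C'] \<open>B \<noteq> C\<close> by (auto simp: disjnt_iff)
  qed
qed

lemma noncrossing_graft:
  assumes "noncrossing \<pi>" "noncrossing \<sigma>"
  shows "noncrossing (graft p \<pi> q \<sigma>)"
  unfolding noncrossing_def
proof (intro ballI allI impI)
  fix B C a b c d
  assume B: "B \<in> graft p \<pi> q \<sigma>" and C: "C \<in> graft p \<pi> q \<sigma>"
    and *: "a < b \<and> b < c \<and> c < d \<and> a \<in> B \<and> c \<in> B \<and> b \<in> C \<and> d \<in> C"
  \<comment> \<open>Only \<open>a\<close> can be the new point \<open>p\<close>; if so, \<open>q\<close> takes its place in a crossing within \<open>\<sigma>\<close>.\<close>
  have range: "p \<le> x" if "x \<in> B \<union> C" for x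
    using partition_onD1[OF partition_on_graft] B C that by fastforce
  have "p \<le> a" using range * by simp
  then have gt: "p < b" "p < c" "p < d" using * by auto
  consider "B \<in> \<pi>" "C \<in> \<pi>" | C' where "B \<in> \<pi>" "C = attach C'" "C' \<in> \<sigma>"
    | B' where "B = attach B'" "B' \<in> \<sigma>" "C \<in> \<pi>"
    | B' C' where "B = attach B'" "B' \<in> \<sigma>" "C = attach C'" "C' \<in> \<sigma>"
    using B C by (auto simp: graft_attach)
  then show "B = C"
  proof cases
    case 1
    then show ?thesis using assms(1) * unfolding noncrossing_def by blast
  next
    case 2
    then have "c < q" "q \<le> b" using left_range[of B c] attach_range[of C' b] * gt by auto
    then show ?thesis using * by simp
  next
    case 3
    then have "d < q" "q \<le> c" using left_range[of C d] attach_range[of B' c] * gt by auto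
    then show ?thesis using * by simp
  next
    case 4
    then have in_\<sigma>: "b \<in> C'" "c \<in> B'" "d \<in> C'" using attach_gt * gt by auto
    obtain a' where a': "a' \<in> B'" "a' \<le> b"
    proof (cases "a = p")
      case True
      then have "q \<in> B'" using * 4 right_range[of B' p] pq by (auto simp: in_attach)
      then show ?thesis using that[of q] right_range[OF 4(4) in_\<sigma>(1)] by simp
    next
      case False
      then show ?thesis using that[of a] * 4 by (auto simp: in_attach)
    qed
    show ?thesis
    proof (cases "a' = b")
      case True
      then show ?thesis using 4 a' in_\<sigma> attach_eq_iff[of B' C' b] by (simp add: in_attach)
    next
      case False
      then have "a' < b" using a' by simp
      then have "B' = C'"
        using assms(2) 4 a' in_\<sigma> * unfolding noncrossing_def by blast
      then show ?thesis using 4 by simp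
    qed
  qed
qed

lemma card_graft: "card (graft p \<pi> q \<sigma>) = card \<pi> + card \<sigma>"
proof -
  have fin: "finite \<pi>" "finite \<sigma>" using finite_elements[OF _ \<pi>] finite_elements[OF _ \<sigma>] by auto
  have ne: "\<exists>x. x \<in> attach B" if "B \<in> \<sigma>" for B
  proof -
    have "B \<noteq> {}" using that partition_onD3[OF \<sigma>] by auto
    then show ?thesis using attach_sub[of B] by blast
  qed
  have "inj_on attach \<sigma>" using ne attach_eq_iff by (metis inj_onI)
  moreover have "\<pi> \<inter> attach ` \<sigma> = {}" using ne left_range attach_range by (fastforce simp: not_le)
  ultimately show ?thesis using fin by (simp add: graft_attach card_Un_disjoint card_image)
qed

lemma no_consecutive_graft:
  assumes "\<And>B x. B \<in> \<pi> \<Longrightarrow> x \<in> B \<Longrightarrow> Suc x \<notin> B" "\<And>B x. B \<in> \<sigma> \<Longrightarrow> x \<in> B \<Longrightarrow> Suc x \<notin> B"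
    "B \<in> graft p \<pi> q \<sigma>" "x \<in> B"
  shows "Suc x \<notin> B"
proof (cases "B \<in> \<pi>")
  case False
  then obtain C where C: "B = attach C" "C \<in> \<sigma>" using assms(3) by (auto simp: graft_attach)
  then show ?thesis
    using assms(2)[OF C(2)] assms(4) right_range[OF C(2)] pq by (fastforce simp: in_attach)
qed (use assms in blast)

lemma difference_graft_left:
  assumes "x \<in> {Suc p..<q}"
  shows "difference (graft p \<pi> q \<sigma>) x = difference \<pi> x"
proof -
  note B = block_of_props[OF \<pi> assms]
  have "block_of (graft p \<pi> q \<sigma>) x = block_of \<pi> x"
    using block_of_eqI[OF partition_on_graft _ B(2)] B(1) by (simp add: graft_attach)
  then show ?thesis by (simp add: difference_def)
qed

lemma difference_graft_right:
  assumes "x \<in> {q..r}"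
  shows "difference (graft p \<pi> q \<sigma>) x = difference \<sigma> x"
proof -
  note B = block_of_props[OF \<sigma> assms]
  let ?B = "block_of \<sigma> x"
  have fin: "finite ?B" by (rule finite_subset[of _ "{q..r}"]) (use right_range[OF B(1)] in auto)
  have "block_of (graft p \<pi> q \<sigma>) x = attach ?B"
    using block_of_eqI[OF partition_on_graft, of "attach ?B" x] B attach_sub by (auto simp: graft_attach)
  moreover have "Max (attach ?B) = Max ?B"
  proof (rule Max_eqI)
    show "finite (attach ?B)" using fin by (simp add: attach_def)
    show "Max ?B \<in> attach ?B" using Max_in[OF fin] B(2) attach_sub by blast
    fix y assume "y \<in> attach ?B"
    then show "y \<le> Max ?B"
      using Max_ge[OF fin] pq by (fastforce simp: in_attach dest: Max_ge[OF fin])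
  qed
  moreover have "{y \<in> attach ?B. x < y} = {y \<in> ?B. x < y}"
    using assms pq by (auto simp: in_attach)
  ultimately show ?thesis by (simp add: difference_def)
qed

lemma difference_graft_root: "difference (graft p \<pi> q \<sigma>) p = int q - int p"
proof -
  have "q \<in> {q..r}" using qr by simp
  note B = block_of_props[OF \<sigma> this]
  let ?B = "block_of \<sigma> q"
  have fin: "finite ?B" by (rule finite_subset[of _ "{q..r}"]) (use right_range[OF B(1)] in auto)
  have "block_of (graft p \<pi> q \<sigma>) p = attach ?B"
    using block_of_eqI[OF partition_on_graft, of "attach ?B" p] B by (auto simp: graft_attach in_attach)
  moreover have "p \<noteq> Max (attach ?B)"
  proof -
    have "q \<le> Max (attach ?B)" using fin B by (intro Max_ge) (auto simp: attach_def)
    then show ?thesis using pq by simp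
  qed
  moreover have "{y \<in> attach ?B. p < y} = ?B"
    using right_range[OF B(1)] pq by (fastforce simp: in_attach)
  moreover have "Min ?B = q" using fin B right_range[OF B(1)] by (intro Min_eqI) auto
  ultimately show ?thesis by (simp add: difference_def)
qed

end

text \<open>
  The first entry is the size of the first subtree, so its other vertices form the forest
  described by the next \<open>h - 1\<close> entries.
\<close>

lemma nested_ConsD:
  assumes "nested (h # c)"
  shows "0 < h" "h \<le> Suc (length c)" "nested (take (h - 1) c)" "nested (drop (h - 1) c)"
proof -
  have *: "0 < (h # c) ! k" "k + (h # c) ! k \<le> Suc (length c)"
    "\<And>l. k \<le> l \<Longrightarrow> l < k + (h # c) ! k \<Longrightarrow> l + (h # c) ! l \<le> k + (h # c) ! k"
    if "k < Suc (length c)" for k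
    using assms that unfolding nested_def by (simp_all del: nth_Cons_Suc)
  show h: "0 < h" "h \<le> Suc (length c)" using *(1,2)[of 0] by auto
  have c: "0 < c ! k" "k + c ! k \<le> length c"
    "\<And>l. k \<le> l \<Longrightarrow> l < k + c ! k \<Longrightarrow> l + c ! l \<le> k + c ! k"
    if "k < length c" for k
  proof -
    show "0 < c ! k" "k + c ! k \<le> length c" using *(1,2)[of "Suc k"] that by auto
    show "l + c ! l \<le> k + c ! k" if "k \<le> l" "l < k + c ! k" for l
      using *(3)[of "Suc k" "Suc l"] that \<open>k < length c\<close> by simp
  qed
  have top: "k + c ! k \<le> h - 1" if "k < h - 1" for k
  proof -
    have "Suc k < h" using that by linarith
    then show ?thesis using *(3)[of 0 "Suc k"] by simp
  qed
  have len: "length (take (h - 1) c) = h - 1" using h by simp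
  show "nested (take (h - 1) c)"
    unfolding nested_def len
  proof (intro allI impI conjI)
    fix k assume k: "k < h - 1"
    then have kc: "k < length c" using h by simp
    show "0 < take (h - 1) c ! k" "k + take (h - 1) c ! k \<le> h - 1"
      using c(1)[OF kc] top[OF k] k by auto
    fix l assume "k \<le> l \<and> l < k + take (h - 1) c ! k"
    then show "l + take (h - 1) c ! l \<le> k + take (h - 1) c ! k"
      using c(3)[OF kc, of l] top[OF k] k by simp
  qed
  show "nested (drop (h - 1) c)"
    unfolding nested_def
  proof (intro allI impI conjI)
    fix k assume k: "k < length (drop (h - 1) c)"
    then have kc: "h - 1 + k < length c" by simp
    show "0 < drop (h - 1) c ! k" "k + drop (h - 1) c ! k \<le> length (drop (h - 1) c)"
      using c(1,2)[OF kc] kc by auto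
    fix l assume "k \<le> l \<and> l < k + drop (h - 1) c ! k"
    then show "l + drop (h - 1) c ! l \<le> k + drop (h - 1) c ! k"
      using c(3)[OF kc, of "h - 1 + l"] kc by simp
  qed
qed

text \<open>
  The starting point \<open>p\<close> is arbitrary because the induction uses the two smaller partitions in place,
  on the intervals starting at \<open>p + 1\<close> and at \<open>p + 2 * h\<close>, without translating them.
\<close>

lemma nested_realizable:
  assumes "nested b"
  shows "\<exists>\<pi>. partition_on {p..p + 2 * length b} \<pi> \<and> noncrossing \<pi> \<and> card \<pi> = length b + 1 \<and>
    (\<forall>B\<in>\<pi>. \<forall>x\<in>B. Suc x \<notin> B) \<and>
    filter (\<lambda>d. d \<noteq> 0) (map (difference \<pi>) [p..<p + 2 * length b + 1]) = map (\<lambda>k. 2 * int k) b"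
  using assms
proof (induction b arbitrary: p rule: length_induct)
  case (1 b p)
  show ?case
  proof (cases b)
    case Nil
    have "partition_on {p} {{p}}" by (rule partition_on_space) simp
    moreover have "noncrossing {{p}}" by (auto simp: noncrossing_def)
    moreover have "difference {{p}} p = 0"
      using block_of_eqI[OF \<open>partition_on {p} {{p}}\<close>, of "{p}" p] by (simp add: difference_def)
    ultimately show ?thesis using Nil by (intro exI[of _ "{{p}}"]) simp
  next
    case (Cons h c)
    note dec = nested_ConsD[OF "1.prems"[unfolded Cons]]
    define B1 B2 where "B1 = take (h - 1) c" and "B2 = drop (h - 1) c"
    have len: "length B1 = h - 1" "length B2 = length c - (h - 1)" "length B1 < length b" "length B2 < length b"
      using dec(1,2) by (auto simp: B1_def B2_def Cons)
    define q r where "q = p + 2 * h" and "r = p + 2 * length b"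
    have ends: "Suc p + 2 * length B1 + 1 = q" "q + 2 * length B2 = r" "Suc p < q" "q \<le> r"
      using dec(1,2) len by (auto simp: q_def r_def Cons)
    obtain \<pi> where \<pi>: "partition_on {Suc p..Suc p + 2 * length B1} \<pi>" "noncrossing \<pi>"
      "card \<pi> = length B1 + 1" "\<forall>B\<in>\<pi>. \<forall>x\<in>B. Suc x \<notin> B"
      "filter (\<lambda>d. d \<noteq> 0) (map (difference \<pi>) [Suc p..<Suc p + 2 * length B1 + 1]) = map (\<lambda>k. 2 * int k) B1"
      using "1.IH"[rule_format, OF len(3) dec(3)[folded B1_def], of "Suc p"] by blast
    obtain \<sigma> where \<sigma>: "partition_on {q..q + 2 * length B2} \<sigma>" "noncrossing \<sigma>"
      "card \<sigma> = length B2 + 1" "\<forall>B\<in>\<sigma>. \<forall>x\<in>B. Suc x \<notin> B"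
      "filter (\<lambda>d. d \<noteq> 0) (map (difference \<sigma>) [q..<q + 2 * length B2 + 1]) = map (\<lambda>k. 2 * int k) B2"
      using "1.IH"[rule_format, OF len(4) dec(4)[folded B2_def], of q] by blast
    have P: "partition_on {Suc p..<q} \<pi>" "partition_on {q..r} \<sigma>"
      using \<pi>(1) \<sigma>(1) ends(2) by (simp_all add: atLeastLessThanSuc_atLeastAtMost flip: ends(1))
    note G = ends(3,4) P
    let ?G = "graft p \<pi> q \<sigma>"
    have "[p..<r + 1] = p # [Suc p..<q] @ [q..<r + 1]"
      using ends(3,4) upt_conv_Cons[of p "r + 1"] upt_add_eq_append[of "Suc p" q "r + 1 - q"]
      by (simp del: upt_Suc)
    moreover have "filter (\<lambda>d. d \<noteq> 0) (map (difference ?G) [Suc p..<q]) =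
        filter (\<lambda>d. d \<noteq> 0) (map (difference \<pi>) [Suc p..<q])"
      using difference_graft_left[OF G] by (intro arg_cong[where f = "filter _"] map_cong) auto
    moreover have "filter (\<lambda>d. d \<noteq> 0) (map (difference ?G) [q..<r + 1]) =
        filter (\<lambda>d. d \<noteq> 0) (map (difference \<sigma>) [q..<r + 1])"
      using difference_graft_right[OF G] by (intro arg_cong[where f = "filter _"] map_cong) auto
    moreover have "difference ?G p = 2 * int h"
      using difference_graft_root[OF G] by (simp add: q_def)
    ultimately have "filter (\<lambda>d. d \<noteq> 0) (map (difference ?G) [p..<r + 1]) =
        2 * int h # map (\<lambda>k. 2 * int k) B1 @ map (\<lambda>k. 2 * int k) B2"
      using \<pi>(5) \<sigma>(5) dec(1) unfolding ends(1,2) by (simp del: upt_Suc)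
    also have "\<dots> = map (\<lambda>k. 2 * int k) b"
      by (simp add: Cons B1_def B2_def flip: map_append)
    finally have "filter (\<lambda>d. d \<noteq> 0) (map (difference ?G) [p..<r + 1]) = map (\<lambda>k. 2 * int k) b" .
    moreover have "card ?G = length b + 1"
      using card_graft[OF G] \<pi>(3) \<sigma>(3) len dec(1,2) by (simp add: Cons)
    ultimately show ?thesis
      using partition_on_graft[OF G] noncrossing_graft[OF G \<pi>(2) \<sigma>(2)] no_consecutive_graft[OF G] \<pi>(4) \<sigma>(4)
      by (intro exI[of _ ?G]) (simp add: r_def del: upt_Suc)
  qed
qed

theorem theorem3p1:
  fixes n :: nat
  assumes "n \<ge> 1"
  shows "bij_betw (f n) (special_partitions n) (S n)"
  unfolding bij_betw_def
proof
  have f: "f n \<pi> = rev (map int (half_gaps n \<pi>))" if "\<pi> \<in> special_partitions n" for \<pi>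
    using f_eq_half_gaps[OF that] .
  show "inj_on (f n) (special_partitions n)"
  proof (rule inj_onI)
    fix \<pi> \<sigma> assume *: "\<pi> \<in> special_partitions n" "\<sigma> \<in> special_partitions n" "f n \<pi> = f n \<sigma>"
    then have "half_gaps n \<pi> = half_gaps n \<sigma>" by (simp add: f inj_map_eq_map)
    then show "\<pi> = \<sigma>" using inj_onD[OF inj_on_half_gaps] * by blast
  qed
  show "f n ` special_partitions n = S n"
  proof (intro set_eqI iffI)
    fix s assume "s \<in> f n ` special_partitions n"
    then show "s \<in> S n" using f nested_half_gaps by (auto simp: S_eq_image)
  next
    fix s assume "s \<in> S n"
    then obtain b where b: "s = rev (map int b)" "length b = n" "nested b" by (auto simp: S_eq_image)
    obtain \<pi> where \<pi>: "partition_on {1..1 + 2 * length b} \<pi>" "noncrossing \<pi>"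
      "card \<pi> = length b + 1" "\<forall>B\<in>\<pi>. \<forall>x\<in>B. Suc x \<notin> B"
      "filter (\<lambda>d. d \<noteq> 0) (map (difference \<pi>) [1..<1 + 2 * length b + 1]) = map (\<lambda>k. 2 * int k) b"
      using nested_realizable[OF b(3)] by blast
    have "\<pi> \<in> special_partitions n" using \<pi>(1-4) b(2) by (auto simp: special_partitions_def)
    moreover have "f n \<pi> = s"
      using \<pi>(5) b(1,2) by (simp add: f_def difference_seq_def o_def rev_map del: upt_Suc flip: rev_map)
    ultimately show "s \<in> f n ` special_partitions n" by blast
  qed
qed

end
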